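(* Let $A\in \mathbb{C}^{n\times n}$, let $k$ be an integer with $0\leq k\leq n$, and let the Hermitian matrix $S(A)=\frac{1}{2i}(A-A^* )$ have eigendecomposition $S(A)=UDU^*$ with $U$ unitary and $D=\operatorname{diag}(\lambda_1,\dots,\lambda_n)$, where the eigenvalues are ordered as $\lambda_1\ge \cdots\ge \lambda_{k_+}> 0$, $\lambda_{k_++1}= \cdots= \lambda_{n-k_-}=0$ and $0> \lambda_{n-k_-+1} \ge \cdots \ge \lambda_{n}$; here $k_+$ is the number of eigenvalues strictly greater than $0$ and $k_-$ the number of eigenvalues strictly smaller than $0$. Let $\hat A = A- i\, U (D-\hat D) U^*$, where $\hat D$ is the diagonal matrix with diagonal elements \[ \hat d_i=\begin{cases} 0 & \text{if } k< i\le k_+ \text{ or } n-k_-< i\le n-k, \\ \lambda_i & \text{otherwise.} \end{cases} \] Then $\hat A\in\mathcal{H}_k$ attains the minimum of $\|A-X\|_2$ over $X\in\mathcal{H}_k$, that is, \[ \min_{X\in \mathcal{H}_k}\|A-X\|_2=\|A-\hat A\|_2 . \]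
   Context: $\mathcal{H}_k$ is the set of Hermitian-plus-rank-$k$ matrices: $X\in\mathbb{C}^{n\times n}$ belongs to $\mathcal{H}_k$ if and only if there exist a Hermitian matrix $H\in\mathbb{C}^{n\times n}$ and matrices $G,B\in\mathbb{C}^{n\times k}$ such that $X = H + GB^*$. $\|\cdot\|_2$ is the spectral norm. The scalar factor $i$ in $\frac{1}{2i}$ and in the definition of $\hat A$ is the imaginary unit. Eigenvalues are counted with multiplicity. *)

theory Defs
  imports
    "HOL-Analysis.L2_Norm"
    "Jordan_Normal_Form.Schur_Decomposition"
begin

definition hermitian_mat :: "complex mat \<Rightarrow> bool" where
  "hermitian_mat H \<longleftrightarrow> square_mat H \<and> mat_adjoint H = H"

definition unitary_mat :: "complex mat \<Rightarrow> bool" where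
  "unitary_mat U \<longleftrightarrow> square_mat U \<and>
     mat_adjoint U * U = 1\<^sub>m (dim_row U) \<and> U * mat_adjoint U = 1\<^sub>m (dim_row U)"

definition euclid_norm :: "complex vec \<Rightarrow> real" where
  "euclid_norm v = L2_set (\<lambda>i. cmod (v $ i)) {..<dim_vec v}"

(* The operator norm induced by the Euclidean norm. The supremum is over the unit ball rather
   than the unit sphere, so the set is nonempty also for matrices without columns. *)
definition spectral_norm :: "complex mat \<Rightarrow> real" where
  "spectral_norm M =
     (SUP v \<in> {v \<in> carrier_vec (dim_col M). euclid_norm v \<le> 1}. euclid_norm (M *\<^sub>v v))"

definition S_part :: "complex mat \<Rightarrow> complex mat" where
  "S_part A = (1 / (2 * \<i>)) \<cdot>\<^sub>m (A - mat_adjoint A)"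

definition hermitian_plus_rank :: "nat \<Rightarrow> nat \<Rightarrow> complex mat set" where
  "hermitian_plus_rank n k =
     {H + G * mat_adjoint B | H G B.
        H \<in> carrier_mat n n \<and> hermitian_mat H \<and> G \<in> carrier_mat n k \<and> B \<in> carrier_mat n k}"

(* Diagonal entries are numbered 1, ..., n, whereas matrix indices in the library start at 0. *)
definition real_diag :: "nat \<Rightarrow> (nat \<Rightarrow> real) \<Rightarrow> complex mat" where
  "real_diag n d = mat_diag n (\<lambda>i. complex_of_real (d (Suc i)))"

definition trunc_eigs :: "nat \<Rightarrow> nat \<Rightarrow> nat \<Rightarrow> nat \<Rightarrow> (nat \<Rightarrow> real) \<Rightarrow> nat \<Rightarrow> real" where
  "trunc_eigs n k kp km l i =
     (if (k < i \<and> i \<le> kp) \<or> (n - km < i \<and> i \<le> n - k) then 0 else l i)"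

end

theory Submission
  imports Defs
begin

text \<open>
  Write \<open>A = H0 + \<i> S\<close> with \<open>H0\<close> and \<open>S = S_part A\<close> Hermitian. Adding a Hermitian matrix to \<open>A\<close>
  leaves \<open>S\<close> unchanged, so membership of \<open>A\<close> in the set of Hermitian-plus-rank-\<open>k\<close> matrices, and
  its distance from that set, depend on the skew part \<open>S\<close> alone.

  A matrix whose skew part has at most \<open>k\<close> positive and at most \<open>k\<close> negative eigenvalues is
  Hermitian plus rank \<open>k\<close>: writing that skew part as \<open>P P* - Q Q*\<close> with \<open>P\<close> and \<open>Q\<close> having
  \<open>k\<close> columns, the rank \<open>k\<close> product \<open>\<i> (P + Q) (P - Q)*\<close> equals \<open>\<i> (P P* - Q Q*)\<close> up to the
  Hermitian matrix \<open>\<i> (Q P* - P Q*)\<close>. Hence \<open>A'\<close>, whose skew part \<open>U D' U*\<close> keeps the positive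
  eigenvalues only among the first \<open>k\<close> and the negative ones only among the last \<open>k\<close>, belongs to the set
  (\<open>hermitian_plus_inertia_k_k\<close>, \<open>replace_S_part_in_hermitian_plus_rank\<close>).

  For the lower bound let \<open>X = H + G B*\<close>. Among the combinations of any \<open>k + 1\<close> eigenvectors of \<open>S\<close>
  there is a nonzero \<open>v\<close> with \<open>B* v = 0\<close>. Its quadratic form under \<open>X\<close> is that of \<open>H\<close> and
  therefore real, so the imaginary part of the form of \<open>A - X\<close> at \<open>v\<close> is the form of \<open>S\<close> at \<open>v\<close>.
  If the chosen eigenvalues are all at least \<open>t\<close>, or all at most \<open>- t\<close>, then this form is at least
  \<open>t |v|^2\<close> in modulus, and the Cauchy-Schwarz inequality gives \<open>t \<le> \<parallel>A - X\<parallel>\<close>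
  (\<open>dist_hermitian_plus_rank_ge\<close>).

  Finally \<open>A - A' = \<i> U (D - D') U*\<close> has norm at most the largest modulus of a discarded eigenvalue.
  A discarded positive eigenvalue has index above \<open>k\<close>, so it is a lower bound \<open>t\<close> for the \<open>k + 1\<close>
  largest eigenvalues; a discarded negative one is likewise an upper bound for the \<open>k + 1\<close> smallest.
  The lower bound on the distance therefore covers the modulus of every discarded eigenvalue.
\<close>

section \<open>Adjoints and the Hermitian inner product\<close>

lemma dim_mat_adjoint [simp]:
  "dim_row (mat_adjoint M) = dim_col M" "dim_col (mat_adjoint M) = dim_row M"
  by (simp_all add: mat_adjoint_def)

lemma index_mat_adjoint [simp]:
  "i < dim_col M \<Longrightarrow> j < dim_row M \<Longrightarrow> mat_adjoint M $$ (i, j) = conjugate (M $$ (j, i))"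
  by (simp add: mat_adjoint_def mat_of_rows_def)

lemma mat_adjoint_carrier [simp]: "M \<in> carrier_mat m n \<Longrightarrow> mat_adjoint M \<in> carrier_mat n m"
  by auto

lemma mat_adjoint_mult_vec_carrier [simp]:
  "M \<in> carrier_mat m n \<Longrightarrow> v \<in> carrier_vec m \<Longrightarrow> mat_adjoint M *\<^sub>v v \<in> carrier_vec n"
  by (rule mult_mat_vec_carrier[OF mat_adjoint_carrier])

lemma cscalar_prod_eq_sum:
  fixes x y :: "complex vec"
  assumes "x \<in> carrier_vec n" "y \<in> carrier_vec n"
  shows "x \<bullet>c y = (\<Sum>i<n. x $ i * cnj (y $ i))"
  unfolding scalar_prod_def lessThan_atLeast0 using assms by (intro sum.cong) auto

lemma cscalar_prod_mult_mat_vec: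
  fixes M :: "complex mat"
  assumes "M \<in> carrier_mat m n" "x \<in> carrier_vec n" "y \<in> carrier_vec m"
  shows "(M *\<^sub>v x) \<bullet>c y = x \<bullet>c (mat_adjoint M *\<^sub>v y)"
proof -
  have "(M *\<^sub>v x) \<bullet>c y = (\<Sum>i<m. \<Sum>j<n. M $$ (i, j) * x $ j * cnj (y $ i))"
    using assms
    by (subst cscalar_prod_eq_sum[of _ m])
       (auto simp: scalar_prod_def sum_distrib_right lessThan_atLeast0 intro!: sum.cong)
  also have "\<dots> = (\<Sum>j<n. \<Sum>i<m. M $$ (i, j) * x $ j * cnj (y $ i))"
    by (rule sum.swap)
  also have "\<dots> = x \<bullet>c (mat_adjoint M *\<^sub>v y)"
    using assms
    by (subst cscalar_prod_eq_sum[of _ n])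
       (auto simp: scalar_prod_def sum_distrib_left lessThan_atLeast0 mult_ac intro!: sum.cong)
  finally show ?thesis .
qed

lemma cnj_cscalar_prod:
  fixes x y :: "complex vec"
  assumes "x \<in> carrier_vec n" "y \<in> carrier_vec n"
  shows "cnj (x \<bullet>c y) = y \<bullet>c x"
  using assms by (simp add: cscalar_prod_eq_sum mult.commute)

section \<open>Euclidean and spectral norm\<close>

lemma euclid_norm_nonneg [simp]: "0 \<le> euclid_norm v"
  by (simp add: euclid_norm_def)

lemma euclid_norm_square:
  assumes "v \<in> carrier_vec n"
  shows "(euclid_norm v)\<^sup>2 = (\<Sum>i<n. (cmod (v $ i))\<^sup>2)"
  using assms by (simp add: euclid_norm_def L2_set_def sum_nonneg)

lemma cscalar_prod_self: "v \<bullet>c v = complex_of_real ((euclid_norm v)\<^sup>2)"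
proof -
  have "v \<bullet>c v = (\<Sum>i<dim_vec v. v $ i * cnj (v $ i))"
    by (rule cscalar_prod_eq_sum) auto
  then show ?thesis
    by (simp add: euclid_norm_square[OF carrier_vec_dim_vec] complex_norm_square del: of_real_power)
qed

lemma euclid_norm_pos:
  assumes "v \<in> carrier_vec n" "v \<noteq> 0\<^sub>v n"
  shows "0 < euclid_norm v"
  using conjugate_square_eq_0_vec[OF assms(1)] assms(2) euclid_norm_nonneg[of v]
  by (auto simp: cscalar_prod_self less_le)

lemma euclid_norm_smult: "euclid_norm (c \<cdot>\<^sub>v v) = cmod c * euclid_norm v"
  unfolding euclid_norm_def
  by (subst L2_set_right_distrib) (auto simp: norm_mult intro!: L2_set_cong)

lemma cmod_cscalar_prod_le:
  assumes "x \<in> carrier_vec n" "y \<in> carrier_vec n"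
  shows "cmod (x \<bullet>c y) \<le> euclid_norm x * euclid_norm y"
proof -
  have "cmod (x \<bullet>c y) \<le> (\<Sum>i<n. cmod (x $ i * cnj (y $ i)))"
    unfolding cscalar_prod_eq_sum[OF assms] by (rule norm_sum)
  also have "\<dots> = (\<Sum>i<n. \<bar>cmod (x $ i)\<bar> * \<bar>cmod (y $ i)\<bar>)"
    by (simp add: norm_mult)
  also have "\<dots> \<le> euclid_norm x * euclid_norm y"
    using assms L2_set_mult_ineq[of "\<lambda>i. cmod (x $ i)" "\<lambda>i. cmod (y $ i)" "{..<n}"]
    by (simp add: euclid_norm_def)
  finally show ?thesis .
qed

text \<open>Boundedness is what makes the supremum in the spectral norm meaningful. Every entry of a vector in
  the unit ball has modulus at most 1, so the sum of the moduli of all matrix entries is a bound.\<close>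

lemma bdd_above_euclid_norm_image:
  "bdd_above ((\<lambda>v. euclid_norm (M *\<^sub>v v)) ` {v \<in> carrier_vec (dim_col M). euclid_norm v \<le> 1})"
proof (rule bdd_aboveI2)
  fix v assume v: "v \<in> {v \<in> carrier_vec (dim_col M). euclid_norm v \<le> 1}"
  have entry: "cmod (v $ j) \<le> 1" if "j < dim_col M" for j
  proof -
    have "cmod (v $ j) \<le> euclid_norm v"
      unfolding euclid_norm_def using v that by (intro member_le_L2_set) auto
    then show ?thesis using v by simp
  qed
  have "euclid_norm (M *\<^sub>v v) \<le> (\<Sum>i<dim_row M. cmod ((M *\<^sub>v v) $ i))"
    unfolding euclid_norm_def by (rule order_trans[OF L2_set_le_sum]) auto
  also have "\<dots> \<le> (\<Sum>i<dim_row M. \<Sum>j<dim_col M. cmod (M $$ (i, j)))"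
  proof (rule sum_mono)
    fix i assume i: "i \<in> {..<dim_row M}"
    have "cmod ((M *\<^sub>v v) $ i) = cmod (\<Sum>j<dim_col M. M $$ (i, j) * v $ j)"
      using i v by (auto simp: scalar_prod_def lessThan_atLeast0 intro!: arg_cong[where f = cmod] sum.cong)
    also have "\<dots> \<le> (\<Sum>j<dim_col M. cmod (M $$ (i, j)) * cmod (v $ j))"
      by (rule order_trans[OF norm_sum]) (simp add: norm_mult)
    also have "\<dots> \<le> (\<Sum>j<dim_col M. cmod (M $$ (i, j)))"
      by (intro sum_mono mult_left_le) (auto simp: entry)
    finally show "cmod ((M *\<^sub>v v) $ i) \<le> (\<Sum>j<dim_col M. cmod (M $$ (i, j)))" .
  qed
  finally show "euclid_norm (M *\<^sub>v v) \<le> (\<Sum>i<dim_row M. \<Sum>j<dim_col M. cmod (M $$ (i, j)))" .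
qed

lemma euclid_norm_zero [simp]: "euclid_norm (0\<^sub>v n) = 0"
  by (simp add: euclid_norm_def L2_set_def)

lemma spectral_norm_nonneg: "0 \<le> spectral_norm M"
  unfolding spectral_norm_def
  by (rule cSUP_upper2[OF bdd_above_euclid_norm_image, of "0\<^sub>v (dim_col M)"]) auto

lemma euclid_norm_mult_mat_vec_le:
  assumes "v \<in> carrier_vec (dim_col M)"
  shows "euclid_norm (M *\<^sub>v v) \<le> spectral_norm M * euclid_norm v"
proof (cases "v = 0\<^sub>v (dim_col M)")
  case True
  then have "M *\<^sub>v v = 0\<^sub>v (dim_row M)" by auto
  then show ?thesis by (simp add: spectral_norm_nonneg)
next
  case False
  define r where "r = euclid_norm v"
  have r: "0 < r" unfolding r_def by (rule euclid_norm_pos[OF assms False])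
  define w where "w = complex_of_real (inverse r) \<cdot>\<^sub>v v"
  have "euclid_norm w = inverse r * r"
    using r by (simp add: w_def euclid_norm_smult norm_inverse r_def)
  then have "euclid_norm w = 1" using r by simp
  then have "euclid_norm (M *\<^sub>v w) \<le> spectral_norm M"
    unfolding spectral_norm_def
    by (intro cSUP_upper bdd_above_euclid_norm_image) (use assms in \<open>auto simp: w_def\<close>)
  moreover have "M *\<^sub>v w = complex_of_real (inverse r) \<cdot>\<^sub>v (M *\<^sub>v v)"
    unfolding w_def using assms by (intro mult_mat_vec[of _ "dim_row M"]) auto
  then have "euclid_norm (M *\<^sub>v w) = inverse r * euclid_norm (M *\<^sub>v v)"
    using r by (simp add: euclid_norm_smult norm_inverse)
  ultimately show ?thesis using r by (simp add: r_def field_simps)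
qed

lemma spectral_norm_leI:
  assumes "\<And>v. v \<in> carrier_vec (dim_col M) \<Longrightarrow> euclid_norm v \<le> 1 \<Longrightarrow> euclid_norm (M *\<^sub>v v) \<le> b"
  shows "spectral_norm M \<le> b"
  unfolding spectral_norm_def
  by (rule cSUP_least) (use assms in \<open>auto intro!: exI[of _ "0\<^sub>v (dim_col M)"]\<close>)

lemma spectral_norm_ge_quadratic_form:
  assumes "M \<in> carrier_mat n n" "v \<in> carrier_vec n" "v \<noteq> 0\<^sub>v n"
    and "t * (euclid_norm v)\<^sup>2 \<le> cmod ((M *\<^sub>v v) \<bullet>c v)"
  shows "t \<le> spectral_norm M"
proof -
  have "cmod ((M *\<^sub>v v) \<bullet>c v) \<le> euclid_norm (M *\<^sub>v v) * euclid_norm v"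
    using assms by (intro cmod_cscalar_prod_le) auto
  also have "\<dots> \<le> spectral_norm M * euclid_norm v * euclid_norm v"
    using assms by (intro mult_right_mono euclid_norm_mult_mat_vec_le) auto
  finally have "t * (euclid_norm v)\<^sup>2 \<le> spectral_norm M * (euclid_norm v)\<^sup>2"
    using assms(4) by (simp add: power2_eq_square)
  then show ?thesis using euclid_norm_pos[OF assms(2,3)] by simp
qed

section \<open>Kernel vectors with prescribed support\<close>

text \<open>A zero row turns the matrix into a singular square one with the same kernel.\<close>

lemma wide_matrix_kernel_nontrivial:
  fixes M :: "'a :: field mat"
  assumes M: "M \<in> carrier_mat k (Suc k)"
  obtains c where "c \<in> carrier_vec (Suc k)" "c \<noteq> 0\<^sub>v (Suc k)" "M *\<^sub>v c = 0\<^sub>v k"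
proof -
  define N where "N = mat (Suc k) (Suc k) (\<lambda>(i, j). if i < k then M $$ (i, j) else 0)"
  have N: "N \<in> carrier_mat (Suc k) (Suc k)" by (simp add: N_def)
  have "N = mat\<^sub>r (Suc k) (Suc k) (\<lambda>i. if i = k then 0\<^sub>v (Suc k) else row N i)"
    by (rule eq_matI) (auto simp: N_def)
  then have "det N = 0"
    using det_row_0[of k "Suc k" "row N"] N by auto
  then obtain c where c: "c \<in> carrier_vec (Suc k)" "c \<noteq> 0\<^sub>v (Suc k)" "N *\<^sub>v c = 0\<^sub>v (Suc k)"
    using det_0_iff_vec_prod_zero_field[OF N] by auto
  have "(M *\<^sub>v c) $ i = 0" if "i < k" for i
  proof -
    have "row N i = row M i" using M that by (auto simp: N_def)
    then have "(M *\<^sub>v c) $ i = (N *\<^sub>v c) $ i" using M N that by simp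
    then show ?thesis using c that by simp
  qed
  then have "M *\<^sub>v c = 0\<^sub>v k" using M by auto
  with c show ?thesis using that by blast
qed

text \<open>The columns indexed by \<open>J\<close> form a matrix with one more column than rows; a kernel vector of it is
  extended by zero.\<close>

lemma kernel_vector_supported_on:
  fixes C :: "'a :: field mat"
  assumes C: "C \<in> carrier_mat k n" and J: "J \<subseteq> {..<n}" "card J = Suc k"
  obtains c where "c \<in> carrier_vec n" "c \<noteq> 0\<^sub>v n" "C *\<^sub>v c = 0\<^sub>v k"
    "\<And>j. j < n \<Longrightarrow> j \<notin> J \<Longrightarrow> c $ j = 0"
proof -
  have finJ: "finite J" using J(1) finite_subset by blast
  obtain f where f: "bij_betw f {..<Suc k} J"
    using ex_bij_betw_nat_finite[OF finJ] J(2) by (auto simp: lessThan_atLeast0)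
  define M where "M = mat k (Suc k) (\<lambda>(i, a). C $$ (i, f a))"
  have "M \<in> carrier_mat k (Suc k)" by (simp add: M_def)
  then obtain d where d: "d \<in> carrier_vec (Suc k)" "d \<noteq> 0\<^sub>v (Suc k)" "M *\<^sub>v d = 0\<^sub>v k"
    by (rule wide_matrix_kernel_nontrivial)
  define c where "c = vec n (\<lambda>j. if j \<in> J then d $ inv_into {..<Suc k} f j else 0)"
  have fn: "f a < n" "f a \<in> J" if "a < Suc k" for a
    using bij_betwE[OF f] J(1) that by auto
  have cf: "c $ f a = d $ a" if "a < Suc k" for a
    using fn[OF that] that bij_betw_inv_into_left[OF f, of a] by (simp add: c_def)
  have "c \<noteq> 0\<^sub>v n"
  proof
    assume "c = 0\<^sub>v n"
    then have "d $ a = 0" if "a < Suc k" for a using cf[OF that] fn[OF that] by simp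
    then have "d = 0\<^sub>v (Suc k)" using d(1) by auto
    with d(2) show False ..
  qed
  moreover have "(C *\<^sub>v c) $ i = 0" if i: "i < k" for i
  proof -
    have "(C *\<^sub>v c) $ i = (\<Sum>j<n. C $$ (i, j) * c $ j)"
      using C i by (simp add: scalar_prod_def c_def lessThan_atLeast0)
    also have "\<dots> = (\<Sum>j\<in>J. C $$ (i, j) * c $ j)"
      using J(1) by (intro sum.mono_neutral_right) (auto simp: c_def)
    also have "\<dots> = (\<Sum>a<Suc k. C $$ (i, f a) * c $ f a)"
      by (rule sum.reindex_bij_betw[OF f, symmetric])
    also have "\<dots> = (\<Sum>a<Suc k. C $$ (i, f a) * d $ a)"
      by (intro sum.cong refl) (simp add: cf)
    also have "\<dots> = (M *\<^sub>v d) $ i"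
      using d(1) i by (simp add: M_def scalar_prod_def lessThan_atLeast0)
    finally show ?thesis using d(3) i by simp
  qed
  then have "C *\<^sub>v c = 0\<^sub>v k" using C by auto
  moreover have "c \<in> carrier_vec n" "\<And>j. j < n \<Longrightarrow> j \<notin> J \<Longrightarrow> c $ j = 0"
    by (auto simp: c_def)
  ultimately show ?thesis using that by blast
qed

section \<open>Quadratic forms and unitary diagonalisation\<close>

lemma smult_mult_mat_vec:
  fixes M :: "'a :: comm_ring mat"
  assumes "M \<in> carrier_mat m n" "v \<in> carrier_vec n"
  shows "(z \<cdot>\<^sub>m M) *\<^sub>v v = z \<cdot>\<^sub>v (M *\<^sub>v v)"
  by (rule eq_vecI) (use assms in \<open>auto simp: scalar_prod_def sum_distrib_left mult.assoc\<close>)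

text \<open>With \<open>z\<close> the form of \<open>A\<close> at \<open>v\<close>, the form of the adjoint is the conjugate of \<open>z\<close>; this links the
  spectrum of \<open>S_part A\<close> to the size of \<open>A\<close>.\<close>

lemma S_part_quadratic_form:
  assumes A: "A \<in> carrier_mat n n" and v: "v \<in> carrier_vec n"
  shows "(S_part A *\<^sub>v v) \<bullet>c v = complex_of_real (Im ((A *\<^sub>v v) \<bullet>c v))"
proof -
  define z where "z = (A *\<^sub>v v) \<bullet>c v"
  have Ad: "mat_adjoint A \<in> carrier_mat n n" using A by simp
  have "(mat_adjoint A *\<^sub>v v) \<bullet>c v = cnj (v \<bullet>c (mat_adjoint A *\<^sub>v v))"
    using Ad v by (subst cnj_cscalar_prod[of _ n]) auto
  also have "\<dots> = cnj z"
    unfolding z_def using A v by (simp add: cscalar_prod_mult_mat_vec)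
  finally have adj: "(mat_adjoint A *\<^sub>v v) \<bullet>c v = cnj z" .
  have "S_part A *\<^sub>v v = (1 / (2 * \<i>)) \<cdot>\<^sub>v (A *\<^sub>v v - mat_adjoint A *\<^sub>v v)"
    unfolding S_part_def using A Ad v
    by (subst smult_mult_mat_vec[of _ n n]) (auto simp: minus_mult_distrib_mat_vec[of _ n n])
  then have "(S_part A *\<^sub>v v) \<bullet>c v = (1 / (2 * \<i>)) * (z - cnj z)"
    using A Ad v by (simp add: minus_scalar_prod_distrib[of _ n] adj z_def)
  also have "\<dots> = complex_of_real (Im z)"
    by (simp add: complex_eq_iff)
  finally show ?thesis by (simp add: z_def)
qed

lemma hermitian_quadratic_form_real:
  assumes H: "H \<in> carrier_mat n n" "hermitian_mat H" and v: "v \<in> carrier_vec n"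
  shows "Im ((H *\<^sub>v v) \<bullet>c v) = 0"
proof -
  have "cnj ((H *\<^sub>v v) \<bullet>c v) = v \<bullet>c (H *\<^sub>v v)"
    using H v by (intro cnj_cscalar_prod) auto
  also have "\<dots> = (H *\<^sub>v v) \<bullet>c v"
    using cscalar_prod_mult_mat_vec[OF H(1) v v] H(2) by (simp add: hermitian_mat_def)
  finally show ?thesis by (simp add: complex_eq_iff)
qed

lemma unitary_mat_carrier:
  assumes "unitary_mat U" "U \<in> carrier_mat n n"
  shows "mat_adjoint U * U = 1\<^sub>m n" "U * mat_adjoint U = 1\<^sub>m n"
  using assms by (auto simp: unitary_mat_def)

lemma isometry_euclid_norm:
  assumes V: "V \<in> carrier_mat m n" "mat_adjoint V * V = 1\<^sub>m n" and c: "c \<in> carrier_vec n"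
  shows "euclid_norm (V *\<^sub>v c) = euclid_norm c"
proof -
  have Va: "mat_adjoint V \<in> carrier_mat n m" using V by simp
  have "(V *\<^sub>v c) \<bullet>c (V *\<^sub>v c) = c \<bullet>c (mat_adjoint V *\<^sub>v (V *\<^sub>v c))"
    using V c by (intro cscalar_prod_mult_mat_vec) auto
  also have "mat_adjoint V *\<^sub>v (V *\<^sub>v c) = c"
    using assoc_mult_mat_vec[OF Va V(1) c] V(2) c by simp
  finally have "(euclid_norm (V *\<^sub>v c))\<^sup>2 = (euclid_norm c)\<^sup>2"
    unfolding cscalar_prod_self of_real_eq_iff .
  then show ?thesis by (simp add: power2_eq_iff_nonneg)
qed

lemma mat_diag_mult_vec:
  assumes "c \<in> carrier_vec n" "i < n"
  shows "(mat_diag n f *\<^sub>v c) $ i = f i * c $ i"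
proof -
  have "(mat_diag n f *\<^sub>v c) $ i = (\<Sum>j\<in>{0..<n}. (if i = j then f j else 0) * c $ j)"
    using assms by (simp add: mat_diag_def scalar_prod_def)
  also have "\<dots> = (\<Sum>j\<in>{0..<n}. if j = i then f i * c $ i else 0)"
    by (intro sum.cong) auto
  finally show ?thesis using assms by simp
qed

lemma mult_mat_vec_conj_unitary:
  assumes U: "U \<in> carrier_mat n n" and D: "D \<in> carrier_mat n n" and x: "x \<in> carrier_vec n"
  shows "(U * D * mat_adjoint U) *\<^sub>v x = U *\<^sub>v (D *\<^sub>v (mat_adjoint U *\<^sub>v x))"
proof -
  have Ua: "mat_adjoint U \<in> carrier_mat n n" using U by simp
  have "(U * D * mat_adjoint U) *\<^sub>v x = (U * D) *\<^sub>v (mat_adjoint U *\<^sub>v x)"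
    by (rule assoc_mult_mat_vec) (use U D Ua x in auto)
  also have "\<dots> = U *\<^sub>v (D *\<^sub>v (mat_adjoint U *\<^sub>v x))"
    by (rule assoc_mult_mat_vec) (use U D Ua x in auto)
  finally show ?thesis .
qed

section \<open>Distance to the Hermitian-plus-rank-k matrices\<close>

text \<open>The \<open>k\<close> linear conditions \<open>B* v = 0\<close> cannot exclude all combinations \<open>v\<close> of the \<open>k + 1\<close>
  eigenvectors indexed by \<open>J\<close>, and on such a \<open>v\<close> the matrix \<open>X\<close> cannot change the imaginary part of
  the quadratic form. The sign \<open>\<sigma>\<close> lets the same argument serve positive and negative eigenvalues.\<close>

lemma dist_hermitian_plus_rank_ge:
  assumes A: "A \<in> carrier_mat n n"
    and U: "U \<in> carrier_mat n n" "unitary_mat U"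
    and S: "S_part A = U * mat_diag n (\<lambda>j. complex_of_real (d j)) * mat_adjoint U"
    and J: "J \<subseteq> {..<n}" "card J = Suc k"
    and \<sigma>: "\<bar>\<sigma>\<bar> = 1" and t: "\<And>j. j \<in> J \<Longrightarrow> t \<le> \<sigma> * d j"
    and X: "X \<in> hermitian_plus_rank n k"
  shows "t \<le> spectral_norm (A - X)"
proof -
  obtain H G B where H: "H \<in> carrier_mat n n" "hermitian_mat H" and G: "G \<in> carrier_mat n k"
    and B: "B \<in> carrier_mat n k" and X_eq: "X = H + G * mat_adjoint B"
    using X by (auto simp: hermitian_plus_rank_def)
  have Ba: "mat_adjoint B \<in> carrier_mat k n" and Ua: "mat_adjoint U \<in> carrier_mat n n"
    using B U by simp_all
  have GB: "G * mat_adjoint B \<in> carrier_mat n n" using G Ba by simp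
  have Xc: "X \<in> carrier_mat n n" unfolding X_eq using GB by simp
  have "mat_adjoint B * U \<in> carrier_mat k n" using Ba U(1) by simp
  then obtain c where c: "c \<in> carrier_vec n" "c \<noteq> 0\<^sub>v n" "(mat_adjoint B * U) *\<^sub>v c = 0\<^sub>v k"
    and supp: "\<And>j. j < n \<Longrightarrow> j \<notin> J \<Longrightarrow> c $ j = 0"
    using kernel_vector_supported_on[OF _ J] by blast
  define v where "v = U *\<^sub>v c"
  have v: "v \<in> carrier_vec n" using U(1) c(1) by (simp add: v_def)
  have norm_v: "euclid_norm v = euclid_norm c"
    unfolding v_def by (rule isometry_euclid_norm[OF U(1) unitary_mat_carrier(1)[OF U(2,1)] c(1)])
  have v0: "v \<noteq> 0\<^sub>v n"
    using norm_v euclid_norm_pos[OF c(1,2)] by auto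
  have "mat_adjoint B *\<^sub>v v = 0\<^sub>v k"
    using assoc_mult_mat_vec[OF Ba U(1) c(1)] c(3) by (simp add: v_def)
  then have "(G * mat_adjoint B) *\<^sub>v v = 0\<^sub>v n"
    using assoc_mult_mat_vec[OF G Ba v] G by auto
  then have "X *\<^sub>v v = H *\<^sub>v v"
    unfolding X_eq using add_mult_distrib_mat_vec[OF H(1) GB v] H(1) v by simp
  then have "((A - X) *\<^sub>v v) \<bullet>c v = (A *\<^sub>v v) \<bullet>c v - (H *\<^sub>v v) \<bullet>c v"
    using A Xc H(1) v minus_mult_distrib_mat_vec[OF A Xc v]
    by (simp add: minus_scalar_prod_distrib[of _ n])
  then have Im_eq: "Im (((A - X) *\<^sub>v v) \<bullet>c v) = Im ((A *\<^sub>v v) \<bullet>c v)"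
    by (simp add: hermitian_quadratic_form_real[OF H v])
  define D where "D = mat_diag n (\<lambda>j. complex_of_real (d j))"
  have D: "D \<in> carrier_mat n n" by (simp add: D_def)
  have coeffs: "mat_adjoint U *\<^sub>v v = c"
    using assoc_mult_mat_vec[OF Ua U(1) c(1)] unitary_mat_carrier(1)[OF U(2,1)] c(1)
    by (simp add: v_def)
  have "S_part A *\<^sub>v v = U *\<^sub>v (D *\<^sub>v c)"
    unfolding S D_def[symmetric] by (simp add: mult_mat_vec_conj_unitary[OF U(1) D v] coeffs)
  then have "(S_part A *\<^sub>v v) \<bullet>c v = (D *\<^sub>v c) \<bullet>c c"
    using cscalar_prod_mult_mat_vec[OF U(1), of "D *\<^sub>v c" v] D c(1) v by (simp add: coeffs)
  also have "\<dots> = complex_of_real (\<Sum>j<n. d j * (cmod (c $ j))\<^sup>2)"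
    unfolding cscalar_prod_eq_sum[OF mult_mat_vec_carrier[OF D c(1)] c(1)] of_real_sum
    by (intro sum.cong refl)
       (simp add: D_def mat_diag_mult_vec[OF c(1)] complex_norm_square mult.assoc del: of_real_power)
  finally have "Im ((A *\<^sub>v v) \<bullet>c v) = (\<Sum>j<n. d j * (cmod (c $ j))\<^sup>2)"
    unfolding S_part_quadratic_form[OF A v] of_real_eq_iff .
  then have Im_sum: "\<sigma> * Im (((A - X) *\<^sub>v v) \<bullet>c v) = (\<Sum>j<n. (\<sigma> * d j) * (cmod (c $ j))\<^sup>2)"
    by (simp add: Im_eq sum_distrib_left mult.assoc)
  have "t * (euclid_norm v)\<^sup>2 = (\<Sum>j<n. t * (cmod (c $ j))\<^sup>2)"
    by (simp add: norm_v euclid_norm_square[OF c(1)] sum_distrib_left)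
  also have "\<dots> \<le> (\<Sum>j<n. (\<sigma> * d j) * (cmod (c $ j))\<^sup>2)"
  proof (rule sum_mono)
    fix j assume "j \<in> {..<n}"
    then show "t * (cmod (c $ j))\<^sup>2 \<le> (\<sigma> * d j) * (cmod (c $ j))\<^sup>2"
      using t[of j] supp[of j] by (cases "j \<in> J") (auto intro: mult_right_mono)
  qed
  also have "\<dots> \<le> \<bar>Im (((A - X) *\<^sub>v v) \<bullet>c v)\<bar>"
    unfolding Im_sum[symmetric] using \<sigma> abs_mult[of \<sigma>] abs_ge_self
    by (metis mult_1)
  also have "\<dots> \<le> cmod (((A - X) *\<^sub>v v) \<bullet>c v)"
    by (rule abs_Im_le_cmod)
  finally show ?thesis
    using A Xc v v0 by (intro spectral_norm_ge_quadratic_form[of _ n v]) auto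
qed

lemma spectral_norm_unitary_diag_le:
  assumes U: "U \<in> carrier_mat n n" "unitary_mat U"
    and z: "cmod z = 1" and f: "\<And>j. j < n \<Longrightarrow> cmod (f j) \<le> b" and b: "0 \<le> b"
  shows "spectral_norm (z \<cdot>\<^sub>m (U * mat_diag n f * mat_adjoint U)) \<le> b"
proof (rule spectral_norm_leI)
  have Ua: "mat_adjoint U \<in> carrier_mat n n" using U by simp
  fix x :: "complex vec"
  assume "x \<in> carrier_vec (dim_col (z \<cdot>\<^sub>m (U * mat_diag n f * mat_adjoint U)))"
    and x1: "euclid_norm x \<le> 1"
  then have x: "x \<in> carrier_vec n" using U by simp
  define y where "y = mat_adjoint U *\<^sub>v x"
  have y: "y \<in> carrier_vec n" using Ua x by (simp add: y_def)
  have Dy: "mat_diag n f *\<^sub>v y \<in> carrier_vec n"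
    by (rule mult_mat_vec_carrier[OF mat_diag_dim y])
  have adj2: "mat_adjoint (mat_adjoint U) = U" using U by (auto intro!: eq_matI)
  have norm_y: "euclid_norm y = euclid_norm x"
    unfolding y_def
    by (rule isometry_euclid_norm[OF Ua _ x]) (simp add: adj2 unitary_mat_carrier(2)[OF U(2,1)])
  have "(euclid_norm (mat_diag n f *\<^sub>v y))\<^sup>2 = (\<Sum>j<n. (cmod (f j * y $ j))\<^sup>2)"
    unfolding euclid_norm_square[OF Dy]
    by (intro sum.cong refl) (simp add: mat_diag_mult_vec[OF y])
  also have "\<dots> \<le> (\<Sum>j<n. b\<^sup>2 * (cmod (y $ j))\<^sup>2)"
    by (intro sum_mono) (auto simp: norm_mult power_mult_distrib intro!: mult_right_mono power_mono f)
  also have "\<dots> = (b * euclid_norm y)\<^sup>2"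
    by (simp add: power_mult_distrib euclid_norm_square[OF y] sum_distrib_left)
  finally have "euclid_norm (mat_diag n f *\<^sub>v y) \<le> b * euclid_norm y"
    using b by (simp add: abs_le_square_iff[symmetric])
  also have "\<dots> \<le> b"
    using b x1 by (simp add: norm_y mult_left_le)
  finally have D_le: "euclid_norm (mat_diag n f *\<^sub>v y) \<le> b" .
  have "(z \<cdot>\<^sub>m (U * mat_diag n f * mat_adjoint U)) *\<^sub>v x
      = z \<cdot>\<^sub>v ((U * mat_diag n f * mat_adjoint U) *\<^sub>v x)"
    using U Ua x by (intro smult_mult_mat_vec[of _ n n]) auto
  also have "\<dots> = z \<cdot>\<^sub>v (U *\<^sub>v (mat_diag n f *\<^sub>v y))"
    using mult_mat_vec_conj_unitary[OF U(1) mat_diag_dim x] by (simp add: y_def)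
  finally show "euclid_norm ((z \<cdot>\<^sub>m (U * mat_diag n f * mat_adjoint U)) *\<^sub>v x) \<le> b"
    using isometry_euclid_norm[OF U(1) unitary_mat_carrier(1)[OF U(2,1)] Dy] D_le
    by (simp add: euclid_norm_smult z)
qed

section \<open>Skew parts with few eigenvalues of each sign\<close>

lemma index_mult_adjoint:
  fixes P Q :: "complex mat"
  assumes "P \<in> carrier_mat n k" "Q \<in> carrier_mat m k" "a < n" "b < m"
  shows "(P * mat_adjoint Q) $$ (a, b) = (\<Sum>j<k. P $$ (a, j) * cnj (Q $$ (b, j)))"
  using assms by (simp add: scalar_prod_def lessThan_atLeast0)

text \<open>Expanding \<open>\<i> (P + Q) (P - Q)*\<close> gives \<open>\<i> (P P* - Q Q*)\<close> and the cross terms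
  \<open>\<i> (Q P* - P Q*)\<close>. The cross terms are Hermitian, so they can be moved into \<open>H\<close>. One rank \<open>k\<close>
  product thus accounts for a skew part whose rank may be as large as \<open>2 k\<close>.\<close>

lemma hermitian_plus_inertia_k_k:
  assumes H: "H \<in> carrier_mat n n" "hermitian_mat H"
    and P: "P \<in> carrier_mat n k" and Q: "Q \<in> carrier_mat n k"
  shows "H + \<i> \<cdot>\<^sub>m (P * mat_adjoint P - Q * mat_adjoint Q) \<in> hermitian_plus_rank n k"
proof -
  define K where "K = H + \<i> \<cdot>\<^sub>m (P * mat_adjoint Q - Q * mat_adjoint P)"
  \<comment> \<open>The sign in \<open>K\<close> is chosen to cancel the cross terms of \<open>G * mat_adjoint B\<close>.\<close>
  define G where "G = \<i> \<cdot>\<^sub>m (P + Q)"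
  define B where "B = P - Q"
  have G: "G \<in> carrier_mat n k" and B: "B \<in> carrier_mat n k" and K: "K \<in> carrier_mat n n"
    using H P Q by (auto simp: G_def B_def K_def)
  have Hsym: "cnj (H $$ (b, a)) = H $$ (a, b)" if "a < n" "b < n" for a b
    using H that index_mat_adjoint[of a H b] by (simp add: hermitian_mat_def)
  have "mat_adjoint K = K"
  proof (rule eq_matI)
    fix a b assume "a < dim_row K" "b < dim_col K"
    then have ab: "a < n" "b < n" using K by auto
    have K_entry: "K $$ (x, y) = H $$ (x, y)
        + \<i> * ((\<Sum>j<k. P $$ (x, j) * cnj (Q $$ (y, j))) - (\<Sum>j<k. Q $$ (x, j) * cnj (P $$ (y, j))))"
      if "x < n" "y < n" for x y
      using H P Q that by (simp add: K_def index_mult_adjoint[of _ n k _ n] del: index_mult_mat(1))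
    then show "mat_adjoint K $$ (a, b) = K $$ (a, b)"
      using ab K by (simp add: K_entry Hsym) (simp add: algebra_simps)
  qed (use K in auto)
  then have "hermitian_mat K" using K by (simp add: hermitian_mat_def)
  moreover have "H + \<i> \<cdot>\<^sub>m (P * mat_adjoint P - Q * mat_adjoint Q) = K + G * mat_adjoint B"
  proof (rule eq_matI)
    fix a b assume "a < dim_row (K + G * mat_adjoint B)" "b < dim_col (K + G * mat_adjoint B)"
    then have ab: "a < n" "b < n" using G B by auto
    have "(G * mat_adjoint B) $$ (a, b)
        = (\<Sum>j<k. \<i> * (P $$ (a, j) + Q $$ (a, j)) * (cnj (P $$ (b, j)) - cnj (Q $$ (b, j))))"
      unfolding index_mult_adjoint[OF G B ab]
      using P Q ab by (intro sum.cong refl) (simp add: G_def B_def)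
    also have "\<dots> = \<i> * ((\<Sum>j<k. P $$ (a, j) * cnj (P $$ (b, j))) - (\<Sum>j<k. P $$ (a, j) * cnj (Q $$ (b, j)))
        + (\<Sum>j<k. Q $$ (a, j) * cnj (P $$ (b, j))) - (\<Sum>j<k. Q $$ (a, j) * cnj (Q $$ (b, j))))"
      by (simp add: algebra_simps sum.distrib sum_subtractf sum_distrib_left)
    finally show "(H + \<i> \<cdot>\<^sub>m (P * mat_adjoint P - Q * mat_adjoint Q)) $$ (a, b) = (K + G * mat_adjoint B) $$ (a, b)"
      using H P Q G B ab
      by (simp add: K_def index_mult_adjoint[of _ n k _ n] algebra_simps del: index_mult_mat(1))
  qed (use H P Q G B K in auto)
  ultimately show ?thesis
    using K G B unfolding hermitian_plus_rank_def by blast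
qed

lemma index_unitary_diag:
  fixes U :: "complex mat"
  assumes U: "U \<in> carrier_mat n n" and ab: "a < n" "b < n"
  shows "(U * mat_diag n f * mat_adjoint U) $$ (a, b) = (\<Sum>j<n. f j * (U $$ (a, j) * cnj (U $$ (b, j))))"
proof -
  have "U * mat_diag n f \<in> carrier_mat n n" using U by simp
  from index_mult_adjoint[OF this U ab] show ?thesis
    using U ab by (simp add: mat_diag_mult_right[OF U] mult_ac)
qed

lemma sum_lessThan_shift:
  fixes g :: "nat \<Rightarrow> 'a :: comm_monoid_add"
  assumes "k \<le> n"
  shows "(\<Sum>j<k. g (n - k + j)) = (\<Sum>j<n. if n - k \<le> j then g j else 0)"
proof -
  have "(\<Sum>j<n. if n - k \<le> j then g j else 0) = (\<Sum>j\<in>{n - k..<n}. g j)"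
    by (intro sum.mono_neutral_cong_right) auto
  also have "\<dots> = (\<Sum>j<k. g (n - k + j))"
    by (rule sum.reindex_bij_witness[of _ "\<lambda>j. n - k + j" "\<lambda>j. j - (n - k)"])
       (use assms in auto)
  finally show ?thesis ..
qed

lemma hermitian_part_hermitian:
  assumes A: "A \<in> carrier_mat n n"
  shows "hermitian_mat (A - \<i> \<cdot>\<^sub>m S_part A)"
proof -
  have "mat_adjoint (A - \<i> \<cdot>\<^sub>m S_part A) = A - \<i> \<cdot>\<^sub>m S_part A"
    by (rule eq_matI) (use A in \<open>auto simp: S_part_def field_simps\<close>)
  then show ?thesis using A by (simp add: hermitian_mat_def S_part_def)
qed

text \<open>Scaling the eigenvectors by square roots of the eigenvalues produces the factors of
  \<open>hermitian_plus_inertia_k_k\<close>. If \<open>2 k > n\<close>, the first \<open>k\<close> and the last \<open>k\<close> indices overlap; taking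
  positive parts in \<open>P\<close> and negative parts in \<open>Q\<close> ensures that no eigenvalue is counted twice.\<close>

lemma replace_S_part_in_hermitian_plus_rank:
  fixes d :: "nat \<Rightarrow> real"
  assumes A: "A \<in> carrier_mat n n" and U: "U \<in> carrier_mat n n" and k: "k \<le> n"
    and pos: "\<And>j. k \<le> j \<Longrightarrow> j < n \<Longrightarrow> d j \<le> 0" and neg: "\<And>j. j < n - k \<Longrightarrow> 0 \<le> d j"
  shows "(A - \<i> \<cdot>\<^sub>m S_part A) + \<i> \<cdot>\<^sub>m (U * mat_diag n (\<lambda>j. complex_of_real (d j)) * mat_adjoint U)
    \<in> hermitian_plus_rank n k"
proof -
  define P where "P = mat n k (\<lambda>(a, j). U $$ (a, j) * complex_of_real (sqrt (max (d j) 0)))"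
  define Q where "Q = mat n k (\<lambda>(a, j). U $$ (a, n - k + j)
    * complex_of_real (sqrt (max (- d (n - k + j)) 0)))"
  have P: "P \<in> carrier_mat n k" and Q: "Q \<in> carrier_mat n k" by (simp_all add: P_def Q_def)
  have sq: "complex_of_real (sqrt (max r 0)) * complex_of_real (sqrt (max r 0))
      = complex_of_real (max r 0)" for r
    by (simp flip: of_real_mult)
  have "U * mat_diag n (\<lambda>j. complex_of_real (d j)) * mat_adjoint U
      = P * mat_adjoint P - Q * mat_adjoint Q"
  proof (rule eq_matI)
    fix a b assume "a < dim_row (P * mat_adjoint P - Q * mat_adjoint Q)"
      "b < dim_col (P * mat_adjoint P - Q * mat_adjoint Q)"
    then have ab: "a < n" "b < n" using P Q by auto
    define u where "u j = U $$ (a, j) * cnj (U $$ (b, j))" for j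
    have "(P * mat_adjoint P) $$ (a, b) = (\<Sum>j<k. complex_of_real (max (d j) 0) * u j)"
      unfolding index_mult_adjoint[OF P P ab]
      using ab by (intro sum.cong refl) (simp add: P_def u_def sq[symmetric] mult_ac)
    also have "\<dots> = (\<Sum>j<n. if j < k then complex_of_real (max (d j) 0) * u j else 0)"
      using k by (intro sum.mono_neutral_cong_left) auto
    finally have PP: "(P * mat_adjoint P) $$ (a, b) = \<dots>" .
    have "(Q * mat_adjoint Q) $$ (a, b)
        = (\<Sum>j<k. complex_of_real (max (- d (n - k + j)) 0) * u (n - k + j))"
      unfolding index_mult_adjoint[OF Q Q ab]
      using ab by (intro sum.cong refl) (simp add: Q_def u_def sq[symmetric] mult_ac)
    also have "\<dots> = (\<Sum>j<n. if n - k \<le> j then complex_of_real (max (- d j) 0) * u j else 0)"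
      by (rule sum_lessThan_shift[OF k])
    finally have QQ: "(Q * mat_adjoint Q) $$ (a, b) = \<dots>" .
    have "(U * mat_diag n (\<lambda>j. complex_of_real (d j)) * mat_adjoint U) $$ (a, b)
        = (\<Sum>j<n. complex_of_real (d j) * u j)"
      unfolding index_unitary_diag[OF U ab] u_def ..
    also have "\<dots> = (P * mat_adjoint P) $$ (a, b) - (Q * mat_adjoint Q) $$ (a, b)"
      unfolding PP QQ sum_subtractf[symmetric]
    proof (intro sum.cong refl)
      fix j assume "j \<in> {..<n}"
      then show "complex_of_real (d j) * u j
          = (if j < k then complex_of_real (max (d j) 0) * u j else 0)
          - (if n - k \<le> j then complex_of_real (max (- d j) 0) * u j else 0)"
        using pos[of j] neg[of j] by (auto simp: max_def)
    qed
    finally show "(U * mat_diag n (\<lambda>j. complex_of_real (d j)) * mat_adjoint U) $$ (a, b)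
        = (P * mat_adjoint P - Q * mat_adjoint Q) $$ (a, b)"
      using P Q ab by simp
  qed (use U P Q in auto)
  moreover have "A - \<i> \<cdot>\<^sub>m S_part A \<in> carrier_mat n n" using A by (auto simp: S_part_def)
  ultimately show ?thesis
    using hermitian_plus_inertia_k_k[OF _ hermitian_part_hermitian[OF A] P Q] by simp
qed

section \<open>The optimal truncation\<close>

text \<open>In a decreasing sequence the positive terms form an initial segment and the negative ones a final
  segment, so that the index conditions of the truncation turn into sign conditions.\<close>

lemma le_card_pos_iff:
  fixes l :: "nat \<Rightarrow> real"
  assumes dec: "\<And>i j. 1 \<le> i \<Longrightarrow> i \<le> j \<Longrightarrow> j \<le> n \<Longrightarrow> l j \<le> l i" and i: "1 \<le> i" "i \<le> n"
  shows "i \<le> card {i \<in> {1..n}. l i > 0} \<longleftrightarrow> l i > 0"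
proof
  assume "l i > 0"
  then have "{1..i} \<subseteq> {i \<in> {1..n}. l i > 0}" using dec[of _ i] i by force
  from card_mono[OF _ this] show "i \<le> card {i \<in> {1..n}. l i > 0}" by simp
next
  assume *: "i \<le> card {i \<in> {1..n}. l i > 0}"
  show "l i > 0"
  proof (rule ccontr)
    assume "\<not> l i > 0"
    have "m < i" if "m \<in> {1..n}" "l m > 0" for m
      using that dec[of i m] i \<open>\<not> l i > 0\<close> by (cases "m < i") auto
    then have "{i \<in> {1..n}. l i > 0} \<subseteq> {1..<i}" by auto
    from card_mono[OF _ this] show False using * i by simp
  qed
qed

lemma card_neg_gt_iff:
  fixes l :: "nat \<Rightarrow> real"
  assumes dec: "\<And>i j. 1 \<le> i \<Longrightarrow> i \<le> j \<Longrightarrow> j \<le> n \<Longrightarrow> l j \<le> l i" and i: "1 \<le> i" "i \<le> n"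
  shows "n - card {i \<in> {1..n}. l i < 0} < i \<longleftrightarrow> l i < 0"
proof
  assume "l i < 0"
  then have "{i..n} \<subseteq> {i \<in> {1..n}. l i < 0}" using dec[of i] i by force
  from card_mono[OF _ this] show "n - card {i \<in> {1..n}. l i < 0} < i" using i by simp
next
  assume *: "n - card {i \<in> {1..n}. l i < 0} < i"
  show "l i < 0"
  proof (rule ccontr)
    assume "\<not> l i < 0"
    have "i < m" if "m \<in> {1..n}" "l m < 0" for m
      using that dec[of m i] i \<open>\<not> l i < 0\<close> by (cases "i < m") auto
    then have "{i \<in> {1..n}. l i < 0} \<subseteq> {Suc i..n}" by (force simp: Suc_le_eq)
    from card_mono[OF _ this] show False using * i by simp
  qed
qed

theorem theorem14:
  fixes n k kp km :: nat
    and A U D D' A' :: "complex mat"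
    and l :: "nat \<Rightarrow> real"
  assumes "A \<in> carrier_mat n n"
    and "k \<le> n"
    and "U \<in> carrier_mat n n" and "unitary_mat U"
    and "D = real_diag n l"
    and "S_part A = U * D * mat_adjoint U"
    and "\<And>i j. 1 \<le> i \<Longrightarrow> i \<le> j \<Longrightarrow> j \<le> n \<Longrightarrow> l j \<le> l i"
    and "kp = card {i \<in> {1..n}. l i > 0}"
    and "km = card {i \<in> {1..n}. l i < 0}"
    and "D' = real_diag n (trunc_eigs n k kp km l)"
    and "A' = A - \<i> \<cdot>\<^sub>m (U * (D - D') * mat_adjoint U)"
  shows "A' \<in> hermitian_plus_rank n k \<and>
    (\<forall>X \<in> hermitian_plus_rank n k. spectral_norm (A - A') \<le> spectral_norm (A - X))"
proof (intro conjI ballI)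
  note A = assms(1) and k = assms(2) and U = assms(3,4) and S = assms(6) and dec = assms(7)
  define d where "d = trunc_eigs n k kp km l"
  have d_eq: "d i = (if (k < i \<and> l i > 0) \<or> (l i < 0 \<and> i \<le> n - k) then 0 else l i)"
    if "1 \<le> i" "i \<le> n" for i
    unfolding d_def trunc_eigs_def assms(8,9)
    by (simp only: le_card_pos_iff[where l = l and n = n, OF dec that]
        card_neg_gt_iff[where l = l and n = n, OF dec that])
  have Dc: "D \<in> carrier_mat n n" and D'c: "D' \<in> carrier_mat n n"
    by (simp_all add: assms(5,10) real_diag_def)
  have diff: "D - D' = mat_diag n (\<lambda>j. complex_of_real (l (Suc j) - d (Suc j)))"
    unfolding assms(5,10) d_def[symmetric] real_diag_def
    by (rule eq_matI) (auto simp: mat_diag_def)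
  define E where "E = U * (D - D') * mat_adjoint U"
  have E: "E \<in> carrier_mat n n" using U by (auto simp: E_def)

  have "A' = (A - \<i> \<cdot>\<^sub>m S_part A) + \<i> \<cdot>\<^sub>m (U * D' * mat_adjoint U)"
  proof (rule eq_matI)
    fix a b assume "a < dim_row ((A - \<i> \<cdot>\<^sub>m S_part A) + \<i> \<cdot>\<^sub>m (U * D' * mat_adjoint U))"
      "b < dim_col ((A - \<i> \<cdot>\<^sub>m S_part A) + \<i> \<cdot>\<^sub>m (U * D' * mat_adjoint U))"
    then have ab: "a < n" "b < n" using U by auto
    have "E $$ (a, b) = S_part A $$ (a, b) - (U * D' * mat_adjoint U) $$ (a, b)"
      unfolding E_def diff
      unfolding S assms(5,10) real_diag_def d_def[symmetric] index_unitary_diag[OF U(1) ab]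
      by (simp add: left_diff_distrib sum_subtractf)
    moreover have "S_part A \<in> carrier_mat n n" using A by (auto simp: S_part_def)
    ultimately show "A' $$ (a, b)
        = ((A - \<i> \<cdot>\<^sub>m S_part A) + \<i> \<cdot>\<^sub>m (U * D' * mat_adjoint U)) $$ (a, b)"
      using A U E ab
      by (simp add: assms(11) E_def[symmetric] right_diff_distrib del: index_mult_mat(1))
  qed (use A U in \<open>auto simp: assms(11) S_part_def\<close>)
  moreover have "\<dots> \<in> hermitian_plus_rank n k"
    unfolding assms(10) real_diag_def d_def[symmetric]
  proof (rule replace_S_part_in_hermitian_plus_rank[OF A U(1) k])
    show "d (Suc j) \<le> 0" if "k \<le> j" "j < n" for j
      using that by (simp add: d_eq)
    show "0 \<le> d (Suc j)" if "j < n - k" for j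
      using that by (simp add: d_eq)
  qed
  ultimately show "A' \<in> hermitian_plus_rank n k" by simp

  fix X assume X: "X \<in> hermitian_plus_rank n k"
  have S': "S_part A = U * mat_diag n (\<lambda>j. complex_of_real (l (Suc j))) * mat_adjoint U"
    using S assms(5) by (simp add: real_diag_def)
  note lower = dist_hermitian_plus_rank_ge[OF A U S' _ _ _ _ X]
  have "A - A' = \<i> \<cdot>\<^sub>m E"
    using A E by (intro eq_matI) (auto simp: assms(11) E_def[symmetric])
  moreover have "spectral_norm (\<i> \<cdot>\<^sub>m E) \<le> spectral_norm (A - X)"
    unfolding E_def diff
  proof (rule spectral_norm_unitary_diag_le[OF U])
    fix j assume j: "j < n"
    let ?i = "Suc j"
    consider "l ?i - d ?i = 0" | "k < ?i" "l ?i - d ?i = l ?i" "0 < l ?i"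
      | "?i \<le> n - k" "l ?i - d ?i = l ?i" "l ?i < 0"
      using d_eq[of ?i] j by (auto split: if_splits)
    then have "\<bar>l ?i - d ?i\<bar> \<le> spectral_norm (A - X)"
    proof cases
      case 1
      then show ?thesis by (simp add: spectral_norm_nonneg)
    next
      case 2
      \<comment> \<open>Indices start at 0 here, so \<open>{..k}\<close> are the positions of the \<open>k + 1\<close> largest eigenvalues.\<close>
      have "l ?i \<le> spectral_norm (A - X)"
        by (rule lower[of "{..k}" 1]) (use 2 j dec in auto)
      with 2 show ?thesis by simp
    next
      case 3
      \<comment> \<open>The positions of the \<open>k + 1\<close> smallest eigenvalues; a discarded index exists, so \<open>k < n\<close>.\<close>
      have "- l ?i \<le> spectral_norm (A - X)"
        by (rule lower[of "{n - k - 1..<n}" "- 1"]) (use 3 j dec in auto)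
      with 3 show ?thesis by simp
    qed
    then show "cmod (complex_of_real (l ?i - d ?i)) \<le> spectral_norm (A - X)"
      by (simp only: norm_of_real)
  qed (simp_all add: spectral_norm_nonneg)
  ultimately show "spectral_norm (A - A') \<le> spectral_norm (A - X)" by simp
qed

end
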